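(* Consider a double round-robin tournament with four teams, under the rules given in the context, after Matchday 5 (i.e. each team has played five matches), where the tie-breaking rule is either goal difference or head-to-head results. Take the following four sets of results for the two games played on Matchday 6 (first game, second game; in each game the goals of the home team are listed first): (a) $M$-$0$, $M$-$0$; (b) $M$-$0$, $0$-$M$; (c) $0$-$M$, $M$-$0$; (d) $0$-$M$, $0$-$M$; where $M$ is a high number (in the sense given in the context). If the position of a team in the final ranking is the same in all four scenarios (a) to (d), then the final position of this team is guaranteed after Matchday 5, that is, it is the same for all possible results of the two games of Matchday 6.
   Context: Double round-robin tournament with four teams: each team plays each of the other three teams exactly twice (once at home, once away). The tournament consists of six rounds (Matchdays 1 to 6); in each round two matches are played so that every team plays exactly one match. The two matches of a round are played simultaneously, so after a given round exactly the results of the matches of that round and all previous rounds are known. Schedule assumption: a team can play its second match against another team only after it has played once against all other teams (so Matchdays 1-3 form a single round-robin, and so do Matchdays 4-6). Match results: the result of a match is a pair of non-negative integers (goals scored by the two teams), without an upper bound. A win is worth 3 points, a draw 1 point, a loss 0 points. Ranking: teams are ranked by total number of points. Ties in points are broken either by goal difference (total goals scored minus total goals conceded in all group matches, higher is better), or by head-to-head results/records (higher number of points obtained in the matches played among the tied teams, followed by superior goal difference in the matches played among the tied teams). The final ranking is the one after all six rounds. High number $M$: $M$ is a number of goals so high that it guarantees for the team scoring $M$ goals to be ranked above any other team having the same number of points without $M$ goals in any match. *)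

theory Defs
  imports Main
begin

text \<open>
  A match is an ordered pair (home team, away team); in a double round-robin every ordered pair of
  distinct teams is exactly one match. A result lists the goals of the home team first.
\<close>

type_synonym 't match = "'t \<times> 't"
type_synonym 't results = "'t match \<Rightarrow> nat \<times> nat"

datatype tie_break = Goal_Difference | Head_To_Head

definition meet :: "(nat \<Rightarrow> 't match set) \<Rightarrow> nat \<Rightarrow> 't \<Rightarrow> 't \<Rightarrow> bool" where
  "meet sched d i j \<longleftrightarrow> (i, j) \<in> sched d \<or> (j, i) \<in> sched d"

text \<open>
  The set \<open>sched d\<close> contains the matches of Matchday \<open>d\<close>. The last clause is the schedule assumption:
  a second match against the same opponent comes only after a match against every other team.
\<close>

definition double_round_robin :: "(nat \<Rightarrow> 't match set) \<Rightarrow> bool" where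
  "double_round_robin sched \<longleftrightarrow>
     (\<forall>d\<in>{1..6}. \<forall>i. (i, i) \<notin> sched d) \<and>
     (\<forall>d\<in>{1..6}. \<forall>i. \<exists>!m. m \<in> sched d \<and> (i = fst m \<or> i = snd m)) \<and>
     (\<forall>i j. i \<noteq> j \<longrightarrow> (\<exists>!d. d \<in> {1..6} \<and> (i, j) \<in> sched d)) \<and>
     (\<forall>d\<in>{1..6}. \<forall>e\<in>{1..6}. \<forall>i j. d < e \<and> meet sched d i j \<and> meet sched e i j \<longrightarrow>
        (\<forall>k. k \<noteq> i \<longrightarrow> (\<exists>c\<in>{1..6}. c < e \<and> meet sched c i k)))"

definition match_points :: "nat \<Rightarrow> nat \<Rightarrow> nat" where
  "match_points own other = (if own > other then 3 else if own = other then 1 else 0)"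

definition points_among :: "'t set \<Rightarrow> 't results \<Rightarrow> 't \<Rightarrow> nat" where
  "points_among T res i =
     (\<Sum>j\<in>T - {i}. match_points (fst (res (i, j))) (snd (res (i, j)))
                 + match_points (snd (res (j, i))) (fst (res (j, i))))"

definition goal_diff_among :: "'t set \<Rightarrow> 't results \<Rightarrow> 't \<Rightarrow> int" where
  "goal_diff_among T res i =
     (\<Sum>j\<in>T - {i}. (int (fst (res (i, j))) - int (snd (res (i, j))))
                 + (int (snd (res (j, i))) - int (fst (res (j, i)))))"

definition points :: "'t results \<Rightarrow> 't \<Rightarrow> nat" where
  "points res i = points_among UNIV res i"

definition tied_teams :: "'t results \<Rightarrow> 't \<Rightarrow> 't set" where
  "tied_teams res i = {j. points res j = points res i}"

definition ranked_above :: "tie_break \<Rightarrow> 't results \<Rightarrow> 't \<Rightarrow> 't \<Rightarrow> bool" where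
  "ranked_above rule res i j \<longleftrightarrow>
     points res i > points res j \<or>
     points res i = points res j \<and>
       (case rule of
          Goal_Difference \<Rightarrow> goal_diff_among UNIV res i > goal_diff_among UNIV res j
        | Head_To_Head \<Rightarrow>
            (let T = tied_teams res i in
               points_among T res i > points_among T res j \<or>
               points_among T res i = points_among T res j \<and>
                 goal_diff_among T res i > goal_diff_among T res j))"

text \<open>
  A final ranking assigns the positions \<open>1, 2, \<dots>\<close> to the teams in accordance with the criteria. Teams
  that are level on all criteria may be ordered in any way, so \<open>final_positions\<close> collects the
  positions left open for a team; the set is a singleton iff the position is determined.
\<close>

definition final_ranking :: "tie_break \<Rightarrow> 't results \<Rightarrow> ('t \<Rightarrow> nat) \<Rightarrow> bool" where
  "final_ranking rule res r \<longleftrightarrow>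
     bij_betw r UNIV {1..card (UNIV :: 't set)} \<and>
     (\<forall>i j. ranked_above rule res i j \<longrightarrow> r i < r j)"

definition final_positions :: "tie_break \<Rightarrow> 't results \<Rightarrow> 't \<Rightarrow> nat set" where
  "final_positions rule res i = {r i | r. final_ranking rule res r}"

text \<open>
  Only the values of \<open>known\<close> outside \<open>{g1, g2}\<close>, the games of the last matchday, matter here.
\<close>

definition final_results ::
  "'t results \<Rightarrow> 't match \<Rightarrow> 't match \<Rightarrow> nat \<times> nat \<Rightarrow> nat \<times> nat \<Rightarrow> 't results" where
  "final_results known g1 g2 x y = known(g1 := x, g2 := y)"

definition scores_among :: "'t set \<Rightarrow> 't results \<Rightarrow> 't \<Rightarrow> nat \<Rightarrow> bool" where
  "scores_among T res i M \<longleftrightarrow>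
     (\<exists>j\<in>T - {i}. fst (res (i, j)) = M \<or> snd (res (j, i)) = M)"

text \<open>
  In each of the four extreme scenarios a team scoring \<open>M\<close> goals must be ranked above every team with
  the same number of points that has not scored \<open>M\<close> goals in any match. The first clause (no team has
  scored that many goals before) keeps this from holding vacuously for a small \<open>M\<close>.

  Under head-to-head, no number of goals can outweigh head-to-head points or make a match against a
  team that is not tied count. The guarantee is therefore required exactly where goals can matter: the
  \<open>M\<close> goals are scored against a tied team, and the head-to-head points are equal. Requiring it for
  all teams with the same number of points would be a stronger condition, which no \<open>M\<close> satisfies for
  some results.
\<close>

definition high_number :: "tie_break \<Rightarrow> 't results \<Rightarrow> 't match \<Rightarrow> 't match \<Rightarrow> nat \<Rightarrow> bool" where
  "high_number rule known g1 g2 M \<longleftrightarrow>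
     (\<forall>i j. i \<noteq> j \<and> (i, j) \<notin> {g1, g2} \<longrightarrow> fst (known (i, j)) < M \<and> snd (known (i, j)) < M) \<and>
     (\<forall>x\<in>{(M, 0), (0, M)}. \<forall>y\<in>{(M, 0), (0, M)}. \<forall>i j.
        let res = final_results known g1 g2 x y; T = tied_teams res i in
          points res i = points res j \<and>
          \<not> scores_among UNIV res j M \<and>
          (case rule of
             Goal_Difference \<Rightarrow> scores_among UNIV res i M
           | Head_To_Head \<Rightarrow>
               scores_among T res i M \<and> points_among T res i = points_among T res j)
          \<longrightarrow> ranked_above rule res i j)"

lemma irrefl_ranked_above: "\<not> ranked_above rule res i i"
  by (auto simp: ranked_above_def Let_def split: tie_break.splits)

lemma trans_ranked_above:
  assumes "ranked_above rule res i j" "ranked_above rule res j k"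
  shows "ranked_above rule res i k"
proof -
  have "tied_teams res j = tied_teams res i" if "points res j = points res i"
    using that by (simp add: tied_teams_def)
  then show ?thesis
    using assms by (cases rule) (auto simp: ranked_above_def Let_def)
qed

lemma final_positions_nonempty:
  fixes i :: 't
  assumes "finite (UNIV :: 't set)"
  shows "final_positions rule res i \<noteq> {}"
proof -
  have "\<exists>r. bij_betw r A {1..card A} \<and> (\<forall>i\<in>A. \<forall>j\<in>A. ranked_above rule res i j \<longrightarrow> r i < r j)"
    if "finite A" for A :: "'t set"
    using that
  proof (induction "card A" arbitrary: A)
    case 0
    then show ?case by (auto simp: bij_betw_def)
  next
    case (Suc n)
    have "\<exists>m\<in>A. \<forall>j\<in>A. \<not> ranked_above rule res m j"
    proof -
      define R where "R = {(j, i). i \<in> A \<and> j \<in> A \<and> ranked_above rule res i j}"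
      have "R \<subseteq> A \<times> A" by (auto simp: R_def)
      then have "finite R" using Suc.prems finite_subset by blast
      moreover have "trans R"
        unfolding R_def using trans_ranked_above by (fastforce simp: trans_def)
      moreover have "irrefl R"
        unfolding R_def using irrefl_ranked_above by (fastforce simp: irrefl_def)
      ultimately have "wf R" by (simp add: finite_acyclic_wf acyclic_irrefl)
      moreover obtain a where "a \<in> A" using Suc.hyps by fastforce
      ultimately obtain m where m: "m \<in> A" "\<And>j. (j, m) \<in> R \<Longrightarrow> j \<notin> A"
        by (rule wfE_min) blast
      have "\<not> ranked_above rule res m j" if "j \<in> A" for j
        using m that unfolding R_def by blast
      with m(1) show ?thesis by (intro bexI[of _ m]) auto
    qed
    then obtain m where m: "m \<in> A" "\<And>j. j \<in> A \<Longrightarrow> \<not> ranked_above rule res m j" by blast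
    have c: "n = card (A - {m})" using Suc m by simp
    obtain r where r: "bij_betw r (A - {m}) {1..n}"
      "\<forall>i\<in>A - {m}. \<forall>j\<in>A - {m}. ranked_above rule res i j \<longrightarrow> r i < r j"
      using Suc.hyps(1)[OF c] Suc.prems c by auto
    define s where "s = r(m := Suc n)"
    have "bij_betw s (A - {m}) {1..n}"
      using r(1) by (subst bij_betw_cong[where g = r]) (auto simp: s_def)
    moreover have "s m = Suc n" by (simp add: s_def)
    moreover have "{1..card A} = insert (Suc n) {1..n}" "A = insert m (A - {m})"
      using Suc.hyps(2) m(1) by auto
    ultimately have "bij_betw s A {1..card A}"
      using notIn_Un_bij_betw[of m "A - {m}" s "{1..n}"] by (simp add: insert_absorb m(1))
    moreover have "\<forall>i\<in>A. \<forall>j\<in>A. ranked_above rule res i j \<longrightarrow> s i < s j"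
    proof (intro ballI impI)
      fix i j assume *: "i \<in> A" "j \<in> A" "ranked_above rule res i j"
      then have "i \<noteq> m" using m by blast
      then have "r i \<le> n" using r(1) * by (auto simp: bij_betw_def)
      then show "s i < s j" using * r(2) \<open>i \<noteq> m\<close> by (auto simp: s_def)
    qed
    ultimately show ?case by blast
  qed
  from this[OF assms] show ?thesis
    unfolding final_positions_def final_ranking_def by fastforce
qed

lemma goal_diff_among_upd:
  assumes "finite T" "h \<noteq> a"
  shows "goal_diff_among T (res((h, a) := x)) i =
    goal_diff_among T (res((h, a) := (0, 0))) i
    + (if i = h \<and> a \<in> T then int (fst x) - int (snd x) else 0)
    + (if i = a \<and> h \<in> T then int (snd x) - int (fst x) else 0)"
proof -
  let ?g = "\<lambda>x j. (int (fst ((res((h, a) := x)) (i, j))) - int (snd ((res((h, a) := x)) (i, j))))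
       + (int (snd ((res((h, a) := x)) (j, i))) - int (fst ((res((h, a) := x)) (j, i))))"
  have "?g x j = ?g (0, 0) j
      + (if j = a then (if i = h then int (fst x) - int (snd x) else 0) else 0)
      + (if j = h then (if i = a then int (snd x) - int (fst x) else 0) else 0)" for j
    using assms(2) by auto
  then show ?thesis
    unfolding goal_diff_among_def using assms by (auto simp: sum.distrib)
qed

text \<open>Every sufficiently large number of goals is a high number.\<close>

lemma high_number_exists:
  fixes sched :: "nat \<Rightarrow> 't match set"
  assumes "card (UNIV :: 't set) = 4" "double_round_robin sched" "sched 6 = {g1, g2}" "g1 \<noteq> g2"
  shows "\<exists>M0. \<forall>M\<ge>M0. high_number rule known g1 g2 M"
proof -
  have fin: "finite (UNIV :: 't set)" using assms(1) card.infinite by fastforce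
  then have finS: "finite T" for T :: "'t set" by (rule finite_subset[OF subset_UNIV])
  obtain h1 a1 h2 a2 where g: "g1 = (h1, a1)" "g2 = (h2, a2)" using surj_pair by metis
  have d6: "(6 :: nat) \<in> {1..6}" by simp
  have irr: "(i, i) \<notin> sched 6" for i
    using bspec[OF assms(2)[unfolded double_round_robin_def, THEN conjunct1] d6] by blast
  have one: "\<exists>!m. m \<in> sched 6 \<and> (i = fst m \<or> i = snd m)" for i
    using bspec[OF assms(2)[unfolded double_round_robin_def, THEN conjunct2, THEN conjunct1] d6] by blast
  have dist: "h1 \<noteq> a1" "h2 \<noteq> a2" using irr[of h1] irr[of h2] assms(3) g by auto
  have mem: "g1 \<in> sched 6" "g2 \<in> sched 6" using assms(3) by simp_all
  have "\<not> ((i = fst g1 \<or> i = snd g1) \<and> (i = fst g2 \<or> i = snd g2))" for i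
    using ex1E[OF one[of i]] mem assms(4) by metis
  from this[of h1] this[of a1] have dist': "h1 \<noteq> h2" "h1 \<noteq> a2" "a1 \<noteq> h2" "a1 \<noteq> a2"
    unfolding g by auto
  define res0 where "res0 = known(g1 := (0, 0), g2 := (0, 0))"
  define B where "B = (\<Sum>T\<in>UNIV. \<Sum>i\<in>UNIV. \<bar>goal_diff_among T res0 i\<bar>)"
  have B: "\<bar>goal_diff_among T res0 i\<bar> \<le> B" for T i
  proof -
    have "\<bar>goal_diff_among T res0 i\<bar> \<le> (\<Sum>i\<in>UNIV. \<bar>goal_diff_among T res0 i\<bar>)"
      by (rule member_le_sum) (simp_all add: fin)
    also have "\<dots> \<le> B" unfolding B_def
      by (rule member_le_sum[where f = "\<lambda>T. \<Sum>i\<in>UNIV. \<bar>goal_diff_among T res0 i\<bar>"])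
        (auto simp: Finite_Set.finite_set fin sum_nonneg)
    finally show ?thesis .
  qed
  define K where "K = (\<Sum>m\<in>UNIV. fst (known m) + snd (known m))"
  have K: "fst (known m) + snd (known m) \<le> K" for m
    unfolding K_def by (rule member_le_sum[where f = "\<lambda>m. fst (known m) + snd (known m)"])
      (auto simp: fin finite_Prod_UNIV)
  have gd: "goal_diff_among T (final_results known g1 g2 x y) i =
    goal_diff_among T res0 i
    + (if i = h1 \<and> a1 \<in> T then int (fst x) - int (snd x) else 0)
    + (if i = a1 \<and> h1 \<in> T then int (snd x) - int (fst x) else 0)
    + (if i = h2 \<and> a2 \<in> T then int (fst y) - int (snd y) else 0)
    + (if i = a2 \<and> h2 \<in> T then int (snd y) - int (fst y) else 0)" for T x y i
  proof -
    have *: "known(g1 := x, g2 := (0, 0)) = (known(g2 := (0, 0)))(g1 := x)"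
       "res0 = (known(g2 := (0, 0)))(g1 := (0, 0))"
      using assms(4) unfolding res0_def by (simp_all add: fun_upd_twist)
    show ?thesis
      using goal_diff_among_upd[OF finS dist(2), of T "known(g1 := x)" y i]
        goal_diff_among_upd[OF finS dist(1), of T "known(g2 := (0, 0))" x i]
      unfolding final_results_def * g[symmetric] by simp
  qed
  show ?thesis
  proof (intro exI allI impI)
    fix M assume M: "Suc (K + nat (2 * B)) \<le> M"
    have KM: "fst (known m) < M \<and> snd (known m) < M" for m using K[of m] M by linarith
    have M': "int M > 2 * B" "M > 0" using M by linarith+
    have sc: "scores_among T (final_results known g1 g2 x y) i M \<longleftrightarrow>
       i = h1 \<and> a1 \<in> T \<and> fst x = M \<or> i = a1 \<and> h1 \<in> T \<and> snd x = M \<or>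
       i = h2 \<and> a2 \<in> T \<and> fst y = M \<or> i = a2 \<and> h2 \<in> T \<and> snd y = M" for T x y i
    proof -
      have n: "fst (known m) \<noteq> M" "snd (known m) \<noteq> M" for m using KM[of m] by auto
      show ?thesis
        unfolding scores_among_def final_results_def g
        using dist dist' n by (auto split: if_splits)
    qed
    show "high_number rule known g1 g2 M"
      unfolding high_number_def Let_def
    proof (intro conjI ballI allI impI)
      fix i j assume "i \<noteq> j \<and> (i, j) \<notin> {g1, g2}"
      show "fst (known (i, j)) < M" "snd (known (i, j)) < M" using KM by auto
    next
      fix x y i j
      let ?res = "final_results known g1 g2 x y" and ?T = "tied_teams (final_results known g1 g2 x y) i"
      assume xy: "x \<in> {(M, 0), (0, M)}" "y \<in> {(M, 0), (0, M)}"
        and A: "points ?res i = points ?res j \<and> \<not> scores_among UNIV ?res j M \<and>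
          (case rule of Goal_Difference \<Rightarrow> scores_among UNIV ?res i M
            | Head_To_Head \<Rightarrow> scores_among ?T ?res i M \<and> points_among ?T ?res i = points_among ?T ?res j)"
      have lt: "goal_diff_among T ?res j < goal_diff_among T ?res i"
        if "scores_among T ?res i M" "i \<in> T" for T
      proof -
        define p q where "p = goal_diff_among T res0 i" and "q = goal_diff_among T res0 j"
        have pq: "q < p + int M" using B[of T i] B[of T j] M' by (simp add: p_def q_def)
        have ns: "\<not> scores_among UNIV ?res j M" using A by blast
        have "x = (M, 0) \<and> y = (M, 0) \<or> x = (M, 0) \<and> y = (0, M) \<or>
              x = (0, M) \<and> y = (M, 0) \<or> x = (0, M) \<and> y = (0, M)"
          using xy by blast
        then show ?thesis
          using that(1) ns pq M'(2) dist dist' unfolding sc gd p_def[symmetric] q_def[symmetric]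
          by (elim disjE conjE) simp_all
      qed
      show "ranked_above rule ?res i j"
        using A lt[of UNIV] lt[of ?T]
        by (cases rule) (auto simp: ranked_above_def Let_def tied_teams_def)
    qed
  qed
qed
end

theory Submission
  imports Defs "HOL-Combinatorics.Transposition"
begin

text \<open>
  Let \<open>A\<close> play \<open>B\<close> and \<open>C\<close> play \<open>D\<close> on Matchday 6, and write \<open>a, b, c, d\<close> for the points after
  Matchday 5. Every team that is not behind \<open>A\<close> on points when \<open>A\<close> wins is ahead of \<open>A\<close> when \<open>A\<close>
  loses. As the positions of \<open>A\<close> agree, these two sets of teams coincide; so \<open>A\<close> loses all ties in
  the extreme scenarios where it wins, and wins all ties in those where it loses. Moreover \<open>b\<close>
  differs from \<open>a\<close> by at least 3, each of \<open>c\<close> and \<open>d\<close> equals \<open>a\<close> or differs from it by at least 3,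
  and \<open>c = a\<close> iff \<open>d = a\<close>.

  Then \<open>c = d = a\<close> is impossible: \<open>C\<close> would be above \<open>A\<close> when both win, and below when both lose,
  although the goal differences, or the matches between \<open>A\<close> and \<open>C\<close>, compare equally in both cases.
  If \<open>b = a + 3\<close> (\<open>b = a - 3\<close> is similar), then \<open>M\<close> being a high number leaves only head-to-head, with
  \<open>B\<close> having more points than \<open>A\<close> among the tied teams, whichever of \<open>C\<close> and \<open>D\<close> wins. So the other
  game must decide who joins the tie, and adding the two inequalities gives \<open>B\<close> too many points.

  What remains is a tie of \<open>A\<close> with just one of \<open>C\<close> and \<open>D\<close>. Under goal difference a high number
  excludes it; under head-to-head it is decided before Matchday 6.
\<close>

section \<open>Final positions and counts of teams ranked above or below\<close>

lemma final_ranking_gt_card_above: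
  assumes r: "final_ranking rule res r"
    and U: "\<And>j :: 't. j \<in> U \<Longrightarrow> ranked_above rule res j i"
  shows "Suc (card U) \<le> r i"
proof -
  have bij: "bij_betw r UNIV {1..card (UNIV :: 't set)}" and above: "\<And>j. j \<in> U \<Longrightarrow> r j < r i"
    using r U by (auto simp: final_ranking_def)
  have pos: "1 \<le> r j" for j
    using bij_betwE[OF bij] by auto
  have "card U = card (r ` U)"
    using bij by (metis bij_betw_def card_image inj_on_subset subset_UNIV)
  also have "\<dots> \<le> card {1..<r i}"
    using above pos by (intro card_mono) auto
  finally show ?thesis
    using pos[of i] by simp
qed

lemma final_ranking_le_card_below:
  assumes r: "final_ranking rule res r"
    and L: "\<And>j :: 't. j \<in> L \<Longrightarrow> ranked_above rule res i j"
  shows "r i + card L \<le> card (UNIV :: 't set)"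
proof -
  have bij: "bij_betw r UNIV {1..card (UNIV :: 't set)}" and below: "\<And>j. j \<in> L \<Longrightarrow> r i < r j"
    using r L by (auto simp: final_ranking_def)
  have le: "r j \<le> card (UNIV :: 't set)" for j
    using bij_betwE[OF bij] by auto
  have "card L = card (r ` L)"
    using bij by (metis bij_betw_def card_image inj_on_subset subset_UNIV)
  also have "\<dots> \<le> card {r i<..card (UNIV :: 't set)}"
    using below le by (intro card_mono) auto
  finally show ?thesis
    using le[of i] by simp
qed

text \<open>Incomparable teams have equal points, hence the same tied set, and so agree on every
  further criterion as well.\<close>

lemma level_ranked_above:
  assumes "\<not> ranked_above rule res i j" "\<not> ranked_above rule res j i"
  shows "ranked_above rule res i k \<longleftrightarrow> ranked_above rule res j k"
    and "ranked_above rule res k i \<longleftrightarrow> ranked_above rule res k j"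
proof -
  have p: "points res i = points res j"
    using assms by (auto simp: ranked_above_def)
  then have T: "tied_teams res i = tied_teams res j"
    by (simp add: tied_teams_def)
  have Tk: "tied_teams res k = tied_teams res j" if "points res k = points res j"
    using that by (simp add: tied_teams_def)
  show "ranked_above rule res i k \<longleftrightarrow> ranked_above rule res j k"
    using assms p T by (cases rule) (auto simp: ranked_above_def Let_def)
  show "ranked_above rule res k i \<longleftrightarrow> ranked_above rule res k j"
    using assms p T Tk by (cases rule) (auto simp: ranked_above_def Let_def)
qed

text \<open>Exchanging \<open>i\<close> with a team level with it turns a final ranking into another
  one, in which \<open>i\<close> has a different position.\<close>

lemma determined_position_comparable:
  assumes P: "final_positions rule res i = {p}" and ij: "i \<noteq> j"
  shows "ranked_above rule res i j \<or> ranked_above rule res j i"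
proof (rule ccontr)
  assume "\<not> ?thesis"
  then have level: "\<not> ranked_above rule res i j" "\<not> ranked_above rule res j i"
    by auto
  have "p \<in> final_positions rule res i"
    using P by simp
  then obtain r where r: "final_ranking rule res r" "r i = p"
    unfolding final_positions_def by blast
  have lt: "r (transpose i j k) < r (transpose i j l)" if "ranked_above rule res k l" for k l
  proof -
    have left: "ranked_above rule res (transpose i j m) n \<longleftrightarrow> ranked_above rule res m n"
      and right: "ranked_above rule res n (transpose i j m) \<longleftrightarrow> ranked_above rule res n m" for m n
      using level_ranked_above[OF level, of n] by (auto simp: transpose_def)
    have "ranked_above rule res (transpose i j k) (transpose i j l)"
      unfolding left right by (rule that)
    then show ?thesis
      using r by (simp add: final_ranking_def)
  qed
  have "final_ranking rule res (r \<circ> transpose i j)"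
    using r(1) lt bij_betw_trans[OF bij_transpose[of i j]] by (auto simp: final_ranking_def)
  moreover have "(r \<circ> transpose i j) i = r j"
    by simp
  ultimately have "r j \<in> final_positions rule res i"
    unfolding final_positions_def mem_Collect_eq by metis
  then have "r j = r i"
    using P r by simp
  then show False
    using r(1) ij by (metis UNIV_I bij_betw_def final_ranking_def inj_onD)
qed

text \<open>The two counting bounds meet at \<open>Suc (card U)\<close>, and some final ranking
  exists, so this position is attained.\<close>

lemma final_positions_eqI:
  fixes i :: 't
  assumes fin: "finite (UNIV :: 't set)" and "i \<notin> U"
    and U: "\<And>j. j \<in> U \<Longrightarrow> ranked_above rule res j i"
    and L: "\<And>j. j \<notin> U \<Longrightarrow> j \<noteq> i \<Longrightarrow> ranked_above rule res i j"
  shows "final_positions rule res i = {Suc (card U)}"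
proof -
  have finU: "finite U"
    using fin by (rule finite_subset[OF subset_UNIV])
  have "card (UNIV :: 't set) = card (insert i U) + card (- insert i U)"
    using fin finU by (subst card_Un_disjoint[symmetric]) (auto intro: finite_subset[OF subset_UNIV])
  then have c: "card (UNIV :: 't set) = Suc (card U) + card (- insert i U)"
    using finU \<open>i \<notin> U\<close> by simp
  have "r i = Suc (card U)" if "final_ranking rule res r" for r
    using final_ranking_gt_card_above[OF that U]
      final_ranking_le_card_below[OF that, of "- insert i U"] L c by fastforce
  then have "final_positions rule res i \<subseteq> {Suc (card U)}"
    by (auto simp: final_positions_def)
  then show ?thesis
    using final_positions_nonempty[OF fin, of rule res i] by blast
qed

text \<open>
  Here \<open>w\<close> and \<open>l\<close> are scenarios in which \<open>i\<close> wins and loses its last game.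
\<close>

lemma same_positions_win_loss:
  fixes i :: 't
  assumes fin: "finite (UNIV :: 't set)"
    and mono: "\<And>j. j \<noteq> i \<Longrightarrow> points w i \<le> points w j \<Longrightarrow> points l i < points l j"
    and P: "final_positions rule w i = P" "final_positions rule l i = P"
  defines "N \<equiv> {j. j \<noteq> i \<and> points w i \<le> points w j}"
  shows "N = {j. j \<noteq> i \<and> points l i < points l j}"
    and "P = {Suc (card N)}"
    and "\<And>j. j \<noteq> i \<Longrightarrow> points w j = points w i \<Longrightarrow> ranked_above rule w j i"
    and "\<And>j. j \<noteq> i \<Longrightarrow> points l j = points l i \<Longrightarrow> ranked_above rule l i j"
proof -
  define D where "D = {j. j \<noteq> i \<and> points l i < points l j}"
  have finS: "finite S" for S :: "'t set"
    using fin by (rule finite_subset[OF subset_UNIV])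
  have comp: "card (UNIV :: 't set) = Suc (card S) + card (- insert i S)" if "i \<notin> S" for S
  proof -
    have "card (UNIV :: 't set) = card (insert i S) + card (- insert i S)"
      by (subst card_Un_disjoint[symmetric]) (auto simp: finS)
    then show ?thesis
      using that finS by simp
  qed
  have iN: "i \<notin> N" "i \<notin> D"
    by (auto simp: N_def D_def)
  have ND: "N \<subseteq> D"
    using mono by (auto simp: N_def D_def)
  have w_below: "ranked_above rule w i j" if "j \<in> - insert i N" for j
    using that by (auto simp: N_def ranked_above_def)
  have l_above: "ranked_above rule l j i" if "j \<in> D" for j
    using that by (auto simp: D_def ranked_above_def)
  \<comment> \<open>All teams outside \<open>N\<close> are below \<open>i\<close> in
    \<open>w\<close>, and all of \<open>D\<close> are above it in \<open>l\<close>. As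
    \<open>N \<subseteq> D\<close>, these bounds leave a single value for a common position.\<close>
  have le: "p \<le> Suc (card N)" if "p \<in> P" for p
  proof -
    obtain r where r: "final_ranking rule w r" "p = r i"
      using \<open>p \<in> P\<close> P(1) by (auto simp: final_positions_def)
    have "r i + card (- insert i N) \<le> card (UNIV :: 't set)"
      by (rule final_ranking_le_card_below[OF r(1) w_below])
    then show ?thesis
      using r(2) comp[OF iN(1)] by simp
  qed
  have ge: "Suc (card D) \<le> p" if "p \<in> P" for p
  proof -
    obtain r where r: "final_ranking rule l r" "p = r i"
      using \<open>p \<in> P\<close> P(2) by (auto simp: final_positions_def)
    show ?thesis
      unfolding r(2) by (rule final_ranking_gt_card_above[OF r(1) l_above])
  qed
  have ne: "P \<noteq> {}"
    using final_positions_nonempty[OF fin] P(1) by blast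
  have "card N \<le> card D"
    by (rule card_mono[OF finS ND])
  moreover obtain p where "p \<in> P"
    using ne by blast
  ultimately have cDN: "card D \<le> card N"
    using le[of p] ge[of p] by simp
  have "q = Suc (card N)" if "q \<in> P" for q
    using le[OF that] ge[OF that] \<open>card N \<le> card D\<close> by simp
  then have PN: "P = {Suc (card N)}"
    using ne by blast
  show eq: "N = {j. j \<noteq> i \<and> points l i < points l j}"
    using card_seteq[OF finS ND cDN] by (simp add: D_def)
  show "P = {Suc (card N)}"
    by (rule PN)
  have "Suc (card N) \<in> final_positions rule w i" "Suc (card N) \<in> final_positions rule l i"
    using P PN by auto
  then obtain r s where r: "final_ranking rule w r" "r i = Suc (card N)"
    and s: "final_ranking rule l s" "s i = Suc (card N)"
    unfolding final_positions_def mem_Collect_eq by metis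
  \<comment> \<open>This position leaves room below \<open>i\<close> only for the teams outside
    \<open>N\<close>, but a team tied in \<open>w\<close> lies in \<open>N\<close>. Dually, a team
    tied in \<open>l\<close> lies outside \<open>D\<close>, which already fills all places above
    \<open>i\<close>.\<close>
  show "ranked_above rule w j i" if j: "j \<noteq> i" "points w j = points w i" for j
  proof (rule ccontr)
    assume "\<not> ?thesis"
    then have "ranked_above rule w i j"
      using determined_position_comparable[of rule w i _ j] P(1) PN j(1) by auto
    then have "r i + card (insert j (- insert i N)) \<le> card (UNIV :: 't set)"
      using w_below by (intro final_ranking_le_card_below[OF r(1)]) auto
    moreover have "j \<in> N"
      using j by (simp add: N_def)
    ultimately show False
      using r(2) comp[OF iN(1)] finS by simp
  qed
  show "ranked_above rule l i j" if j: "j \<noteq> i" "points l j = points l i" for j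
  proof (rule ccontr)
    assume "\<not> ?thesis"
    then have "ranked_above rule l j i"
      using determined_position_comparable[of rule l i _ j] P(2) PN j(1) by auto
    then have "Suc (card (insert j D)) \<le> s i"
      using l_above by (intro final_ranking_gt_card_above[OF s(1)]) auto
    moreover have "j \<notin> D"
      using j by (simp add: D_def)
    ultimately show False
      using s(2) eq finS by (simp add: D_def)
  qed
qed

section \<open>Scores by pairs of teams, and the last matchday as seen by one team\<close>

definition duel_points :: "'t results \<Rightarrow> 't \<Rightarrow> 't \<Rightarrow> nat" where
  "duel_points res i j = match_points (fst (res (i, j))) (snd (res (i, j)))
                       + match_points (snd (res (j, i))) (fst (res (j, i)))"

definition duel_goals :: "'t results \<Rightarrow> 't \<Rightarrow> 't \<Rightarrow> int" where
  "duel_goals res i j = (int (fst (res (i, j))) - int (snd (res (i, j))))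
                      + (int (snd (res (j, i))) - int (fst (res (j, i))))"

lemma match_points_le: "match_points m n \<le> 3"
  by (simp add: match_points_def)

text \<open>
  The team \<open>A\<close> in question plays \<open>B\<close> in game \<open>g\<close>, at home or away; in \<open>outcome u v\<close> the goals of \<open>A\<close>
  come first in \<open>u\<close> in either case.
\<close>

locale final_matchday =
  fixes A B C D :: 't and known :: "'t results" and g :: "'t match"
    and rule :: tie_break and M :: nat and P :: "nat set"
  assumes teams: "UNIV = {A, B, C, D}"
    and distinct: "A \<noteq> B" "A \<noteq> C" "A \<noteq> D" "B \<noteq> C" "B \<noteq> D" "C \<noteq> D"
    and game: "g = (A, B) \<or> g = (B, A)"
    and high: "high_number rule known g (C, D) M"
    and same: "\<And>u v. u \<in> {(M, 0), (0, M)} \<Longrightarrow> v \<in> {(M, 0), (0, M)} \<Longrightarrow>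
      final_positions rule
        (final_results known g (C, D) (if fst g = A then u else prod.swap u) v) A = P"
begin

definition outcome :: "nat \<times> nat \<Rightarrow> nat \<times> nat \<Rightarrow> 't results" where
  "outcome u v = final_results known g (C, D) (if fst g = A then u else prod.swap u) v"

text \<open>
  For the pairs \<open>A, B\<close> and \<open>C, D\<close> that play on Matchday 6, the points and the goal difference of \<open>X\<close>
  in its earlier match against \<open>Y\<close>. Other pairs are never used.
\<close>

definition leg_points :: "'t \<Rightarrow> 't \<Rightarrow> nat" where
  "leg_points X Y = (if (X, Y) = g \<or> (X, Y) = (C, D)
     then match_points (snd (known (Y, X))) (fst (known (Y, X)))
     else match_points (fst (known (X, Y))) (snd (known (X, Y))))"

definition leg_goals :: "'t \<Rightarrow> 't \<Rightarrow> int" where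
  "leg_goals X Y = (if (X, Y) = g \<or> (X, Y) = (C, D)
     then int (snd (known (Y, X))) - int (fst (known (Y, X)))
     else int (fst (known (X, Y))) - int (snd (known (X, Y))))"

lemmas distinct' = distinct distinct[symmetric]

lemma team_cases: "X = A \<or> X = B \<or> X = C \<or> X = D"
  using teams by auto

lemma finite_teams: "finite (S :: 't set)"
  by (rule finite_subset[OF subset_UNIV]) (simp add: teams)

lemma duel_points_outcome:
  "duel_points (outcome u v) A B = leg_points A B + match_points (fst u) (snd u)"
  "duel_points (outcome u v) B A = leg_points B A + match_points (snd u) (fst u)"
  "duel_points (outcome u v) C D = leg_points C D + match_points (fst v) (snd v)"
  "duel_points (outcome u v) D C = leg_points D C + match_points (snd v) (fst v)"
  "X \<in> {A, B} \<Longrightarrow> Y \<in> {C, D} \<Longrightarrow> duel_points (outcome u v) X Y = duel_points known X Y"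
  "X \<in> {A, B} \<Longrightarrow> Y \<in> {C, D} \<Longrightarrow> duel_points (outcome u v) Y X = duel_points known Y X"
  using game distinct'
  by (auto simp: duel_points_def outcome_def final_results_def leg_points_def)

lemma duel_goals_outcome:
  "duel_goals (outcome u v) A B = leg_goals A B + int (fst u) - int (snd u)"
  "duel_goals (outcome u v) B A = leg_goals B A + int (snd u) - int (fst u)"
  "duel_goals (outcome u v) C D = leg_goals C D + int (fst v) - int (snd v)"
  "duel_goals (outcome u v) D C = leg_goals D C + int (snd v) - int (fst v)"
  "X \<in> {A, B} \<Longrightarrow> Y \<in> {C, D} \<Longrightarrow> duel_goals (outcome u v) X Y = duel_goals known X Y"
  "X \<in> {A, B} \<Longrightarrow> Y \<in> {C, D} \<Longrightarrow> duel_goals (outcome u v) Y X = duel_goals known Y X"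
  using game distinct'
  by (auto simp: duel_goals_def outcome_def final_results_def leg_goals_def)

lemma sum_teams:
  fixes f :: "'t \<Rightarrow> 'b :: comm_monoid_add"
  shows "sum f S = (if A \<in> S then f A else 0) + (if B \<in> S then f B else 0)
    + (if C \<in> S then f C else 0) + (if D \<in> S then f D else 0)"
proof -
  have "sum f S = (\<Sum>j\<in>UNIV. if j \<in> S then f j else 0)"
    by (simp add: sum.If_cases finite_teams)
  then show ?thesis
    using distinct' by (simp add: teams add.assoc)
qed

lemma points_among_duel: "points_among T res X = sum (duel_points res X) (T - {X})"
  by (simp add: points_among_def duel_points_def)

lemma goal_diff_among_duel: "goal_diff_among T res X = sum (duel_goals res X) (T - {X})"
  by (simp add: goal_diff_among_def duel_goals_def)

text \<open>The points after Matchday 5.\<close>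

definition base :: "'t \<Rightarrow> nat" where
  "base X = (\<Sum>Y\<in>UNIV - {X}. if {X, Y} = {A, B} \<or> {X, Y} = {C, D} then leg_points X Y
     else duel_points known X Y)"

lemma base_eq:
  "base A = leg_points A B + duel_points known A C + duel_points known A D"
  "base B = leg_points B A + duel_points known B C + duel_points known B D"
  unfolding base_def sum_teams using distinct' by (auto simp: doubleton_eq_iff)

lemma points_outcome:
  "points (outcome u v) A = base A + match_points (fst u) (snd u)"
  "points (outcome u v) B = base B + match_points (snd u) (fst u)"
  "points (outcome u v) C = base C + match_points (fst v) (snd v)"
  "points (outcome u v) D = base D + match_points (snd v) (fst v)"
  unfolding points_def points_among_duel base_def sum_teams using distinct'
  by (auto simp: duel_points_outcome doubleton_eq_iff)

lemma points_among_outcome: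
  "points_among T (outcome u v) A =
     (if B \<in> T then leg_points A B + match_points (fst u) (snd u) else 0)
     + (if C \<in> T then duel_points known A C else 0) + (if D \<in> T then duel_points known A D else 0)"
  "points_among T (outcome u v) B =
     (if A \<in> T then leg_points B A + match_points (snd u) (fst u) else 0)
     + (if C \<in> T then duel_points known B C else 0) + (if D \<in> T then duel_points known B D else 0)"
  unfolding points_among_duel sum_teams using distinct' by (auto simp: duel_points_outcome)

lemma leg_points_le: "leg_points X Y \<le> 3"
  by (simp add: leg_points_def match_points_le)

lemma known_lt:
  assumes "X \<noteq> Y" "(X, Y) \<noteq> g" "(X, Y) \<noteq> (C, D)"
  shows "fst (known (X, Y)) < M" "snd (known (X, Y)) < M"
  using high assms by (auto simp: high_number_def)

lemma M_pos: "0 < M"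
  using known_lt(1)[of A C] game distinct' by (cases "M = 0") auto

text \<open>Earlier matches have fewer than \<open>M\<close> goals on either side, so only the last
  two games can provide \<open>M\<close> goals.\<close>

lemma scores_among_outcome:
  "scores_among T (outcome u v) X M \<longleftrightarrow>
     X = A \<and> B \<in> T \<and> fst u = M \<or> X = B \<and> A \<in> T \<and> snd u = M \<or>
     X = C \<and> D \<in> T \<and> fst v = M \<or> X = D \<and> C \<in> T \<and> snd v = M"
proof -
  have n: "fst (known (X, Y)) \<noteq> M" "snd (known (X, Y)) \<noteq> M"
    if "X \<noteq> Y" "(X, Y) \<noteq> g" "(X, Y) \<noteq> (C, D)" for X Y
    using known_lt[OF that] by auto
  have *: "scores_among T (outcome u v) X M \<longleftrightarrow>
     (\<exists>j\<in>T. X \<noteq> j \<and> (fst (outcome u v (X, j)) = M \<or> snd (outcome u v (j, X)) = M))"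
    by (auto simp: scores_among_def)
  have bex: "(\<exists>j\<in>T. Q j) \<longleftrightarrow> A \<in> T \<and> Q A \<or> B \<in> T \<and> Q B \<or> C \<in> T \<and> Q C \<or> D \<in> T \<and> Q D" for Q
  proof -
    have "(\<exists>j\<in>T. Q j) \<longleftrightarrow> (\<exists>j\<in>UNIV. j \<in> T \<and> Q j)"
      by auto
    then show ?thesis
      by (simp only: teams bex_simps empty_iff simp_thms)
  qed
  show ?thesis
    unfolding * unfolding bex outcome_def final_results_def
    using game team_cases[of X] n by (elim disjE) (simp_all add: distinct')
qed

text \<open>Listing the goals of \<open>A\<close> first only permutes the two extreme results, so
  the guarantee of a high number carries over to \<open>outcome\<close>.\<close>

lemma outcome_high:
  assumes "u \<in> {(M, 0), (0, M)}" "v \<in> {(M, 0), (0, M)}"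
    "points (outcome u v) X = points (outcome u v) Y"
    "\<not> scores_among UNIV (outcome u v) Y M"
    "case rule of Goal_Difference \<Rightarrow> scores_among UNIV (outcome u v) X M
     | Head_To_Head \<Rightarrow> scores_among (tied_teams (outcome u v) X) (outcome u v) X M \<and>
         points_among (tied_teams (outcome u v) X) (outcome u v) X
         = points_among (tied_teams (outcome u v) X) (outcome u v) Y"
  shows "ranked_above rule (outcome u v) X Y"
proof -
  have "(if fst g = A then u else prod.swap u) \<in> {(M, 0), (0, M)}"
    using assms(1) by auto
  with high assms(2-5) show ?thesis
    unfolding high_number_def Let_def outcome_def by blast
qed

section \<open>Consequences of equal positions in the extreme scenarios\<close>

lemma match_points_M:
  "match_points M 0 = 3" "match_points 0 M = 0"
  using M_pos by (simp_all add: match_points_def)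

text \<open>A loss instead of a win costs \<open>A\<close> three points, while no other team gets
  fewer.\<close>

lemma ahead_win_loss:
  assumes "j \<noteq> A" "points (outcome (M, 0) v) A \<le> points (outcome (M, 0) v) j"
  shows "points (outcome (0, M) v) A < points (outcome (0, M) v) j"
  using assms team_cases[of j] by (auto simp: points_outcome match_points_M)

lemma same_outcome:
  "u \<in> {(M, 0), (0, M)} \<Longrightarrow> v \<in> {(M, 0), (0, M)} \<Longrightarrow> final_positions rule (outcome u v) A = P"
  unfolding outcome_def by (rule same)

context
  fixes v :: "nat \<times> nat"
  assumes v: "v \<in> {(M, 0), (0, M)}"
begin

lemma scenarios:
  "final_positions rule (outcome (M, 0) v) A = P" "final_positions rule (outcome (0, M) v) A = P"
  using same_outcome v by auto

lemma ahead_iff: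
  assumes "j \<noteq> A"
  shows "points (outcome (M, 0) v) A \<le> points (outcome (M, 0) v) j \<longleftrightarrow>
    points (outcome (0, M) v) A < points (outcome (0, M) v) j"
  using same_positions_win_loss(1)[OF finite_teams _ scenarios] ahead_win_loss assms by blast

lemma position_eq:
  "P = {Suc (card {j. j \<noteq> A \<and> points (outcome (M, 0) v) A \<le> points (outcome (M, 0) v) j})}"
  by (rule same_positions_win_loss(2)[OF finite_teams ahead_win_loss scenarios])

lemma tied_win:
  assumes "j \<noteq> A" "points (outcome (M, 0) v) j = points (outcome (M, 0) v) A"
  shows "ranked_above rule (outcome (M, 0) v) j A" "\<not> ranked_above rule (outcome (M, 0) v) A j"
proof -
  show above: "ranked_above rule (outcome (M, 0) v) j A"
    by (rule same_positions_win_loss(3)[OF finite_teams ahead_win_loss scenarios assms])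
  show "\<not> ranked_above rule (outcome (M, 0) v) A j"
    using trans_ranked_above[OF above] irrefl_ranked_above by metis
qed

lemma tied_loss:
  assumes "j \<noteq> A" "points (outcome (0, M) v) j = points (outcome (0, M) v) A"
  shows "ranked_above rule (outcome (0, M) v) A j" "\<not> ranked_above rule (outcome (0, M) v) j A"
proof -
  show above: "ranked_above rule (outcome (0, M) v) A j"
    by (rule same_positions_win_loss(4)[OF finite_teams ahead_win_loss scenarios assms])
  show "\<not> ranked_above rule (outcome (0, M) v) j A"
    using trans_ranked_above[OF above] irrefl_ranked_above by metis
qed

end

lemma card_teams_except:
  "card {j. j \<noteq> A \<and> Q j} = of_bool (Q B) + of_bool (Q C) + of_bool (Q D)"
  using sum_teams[of "\<lambda>_. 1 :: nat" "{j. j \<noteq> A \<and> Q j}"] distinct' by simp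

text \<open>The two sides of \<open>ahead_iff\<close> are different thresholds, so no team lies
  between them. For \<open>B\<close> they are \<open>base A + 3 \<le> base B\<close> and
  \<open>base A < base B + 3\<close>. For \<open>C\<close> they are
  \<open>base A \<le> base C\<close> and \<open>base A < base C + 3\<close> if it wins, and
  \<open>base A + 3 \<le> base C\<close> and \<open>base A < base C\<close> if it loses; likewise
  for \<open>D\<close>.\<close>

lemma base_gaps:
  "base A + 3 \<le> base B \<or> base B + 3 \<le> base A"
  "base A + 3 \<le> base C \<or> base C = base A \<or> base C + 3 \<le> base A"
  "base A + 3 \<le> base D \<or> base D = base A \<or> base D + 3 \<le> base A"
  using ahead_iff[of "(M, 0)"] ahead_iff[of "(0, M)"] distinct'
  by (force simp: points_outcome match_points_M)+

text \<open>The number of teams not behind a winning \<open>A\<close> is the same for both results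
  of the other game. A level \<open>C\<close> or \<open>D\<close> is counted only when it wins,
  whereas \<open>B\<close> and teams at a distance of at least 3 are counted always or
  never.\<close>

lemma base_C_eq_iff: "base C = base A \<longleftrightarrow> base D = base A"
proof -
  have "card {j. j \<noteq> A \<and> points (outcome (M, 0) (M, 0)) A \<le> points (outcome (M, 0) (M, 0)) j}
      = card {j. j \<noteq> A \<and> points (outcome (M, 0) (0, M)) A \<le> points (outcome (M, 0) (0, M)) j}"
    using position_eq[of "(M, 0)"] position_eq[of "(0, M)"] by simp
  then show ?thesis
    using base_gaps unfolding card_teams_except
    by (simp add: points_outcome match_points_M) (auto simp: of_bool_def split: if_splits)
qed

lemma ranked_above_tied_H2H:
  assumes "rule = Head_To_Head" "points res X = points res A" "points res Y = points res A"
  shows "ranked_above rule res X Y \<longleftrightarrow>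
    points_among (tied_teams res A) res X > points_among (tied_teams res A) res Y \<or>
    points_among (tied_teams res A) res X = points_among (tied_teams res A) res Y \<and>
    goal_diff_among (tied_teams res A) res X > goal_diff_among (tied_teams res A) res Y"
  using assms by (auto simp: ranked_above_def Let_def tied_teams_def)

section \<open>Impossible point gaps\<close>

lemma base_B_not_win: "base B \<noteq> base A + 3"
proof
  assume b: "base B = base A + 3"
  \<comment> \<open>\<open>A\<close> and \<open>B\<close> are tied and only \<open>A\<close> has
    scored \<open>M\<close> goals against the other, so a high number would put \<open>A\<close>
    above \<open>B\<close>, against \<open>tied_win\<close>, unless head-to-head points already
    separate them.\<close>
  have key: "rule = Head_To_Head \<and>
    points_among (tied_teams (outcome (M, 0) v) A) (outcome (M, 0) v) A
    < points_among (tied_teams (outcome (M, 0) v) A) (outcome (M, 0) v) B"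
    if v: "v \<in> {(M, 0), (0, M)}" for v
  proof -
    let ?R = "outcome (M, 0) v" and ?T = "tied_teams (outcome (M, 0) v) A"
    have tie: "points ?R B = points ?R A"
      using b by (simp add: points_outcome match_points_M)
    have sc: "scores_among UNIV ?R A M" "scores_among ?T ?R A M" "\<not> scores_among UNIV ?R B M"
      using tie M_pos distinct' by (auto simp: scores_among_outcome tied_teams_def)
    have above: "ranked_above rule ?R B A" "\<not> ranked_above rule ?R A B"
      using tied_win[OF v, of B] tie distinct' by auto
    have "\<not> (case rule of Goal_Difference \<Rightarrow> scores_among UNIV ?R A M
     | Head_To_Head \<Rightarrow> scores_among ?T ?R A M \<and> points_among ?T ?R A = points_among ?T ?R B)"
      using outcome_high[OF insertI1 v tie[symmetric] sc(3)] above(2) by blast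
    then have "rule = Head_To_Head" "points_among ?T ?R A \<noteq> points_among ?T ?R B"
      using sc by (auto split: tie_break.splits)
    with above(1) show ?thesis
      using ranked_above_tied_H2H[of ?R B A] tie by auto
  qed
  \<comment> \<open>A tied set \<open>{A, B}\<close> would give
    \<open>leg_points A B + 3 < leg_points B A\<close>. Otherwise \<open>C\<close> joins for one
    \<open>v\<close> and \<open>D\<close> for the other; adding both inequalities and using
    \<open>base_eq\<close> gives \<open>leg_points A B + 5 \<le> leg_points B A\<close>.\<close>
  have "leg_points A B \<le> 3" "leg_points B A \<le> 3"
    by (rule leg_points_le)+
  with key[of "(M, 0)"] key[of "(0, M)"] base_eq b base_gaps(2,3) base_C_eq_iff show False
    by (auto simp: points_among_outcome tied_teams_def points_outcome match_points_M split: if_splits)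
qed

text \<open>Mirror image of \<open>base_B_not_win\<close>: \<open>B\<close> now wins with
  \<open>M\<close> goals, and the argument runs with \<open>A\<close> and \<open>B\<close>
  exchanged.\<close>

lemma base_B_not_loss: "base B + 3 \<noteq> base A"
proof
  assume b: "base B + 3 = base A"
  have key: "rule = Head_To_Head \<and>
    points_among (tied_teams (outcome (0, M) v) A) (outcome (0, M) v) B
    < points_among (tied_teams (outcome (0, M) v) A) (outcome (0, M) v) A"
    if v: "v \<in> {(M, 0), (0, M)}" for v
  proof -
    let ?R = "outcome (0, M) v" and ?T = "tied_teams (outcome (0, M) v) A"
    have tie: "points ?R B = points ?R A"
      using b by (simp add: points_outcome match_points_M)
    have T: "tied_teams ?R B = ?T"
      using tie by (simp add: tied_teams_def)
    have sc: "scores_among UNIV ?R B M" "scores_among ?T ?R B M" "\<not> scores_among UNIV ?R A M"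
      using tie M_pos distinct' by (auto simp: scores_among_outcome tied_teams_def)
    have above: "ranked_above rule ?R A B" "\<not> ranked_above rule ?R B A"
      using tied_loss[OF v, of B] tie distinct' by auto
    have "\<not> (case rule of Goal_Difference \<Rightarrow> scores_among UNIV ?R B M
     | Head_To_Head \<Rightarrow> scores_among ?T ?R B M \<and> points_among ?T ?R B = points_among ?T ?R A)"
      using outcome_high[OF insertI2[OF insertI1] v tie sc(3)] above(2) unfolding T by blast
    then have "rule = Head_To_Head" "points_among ?T ?R A \<noteq> points_among ?T ?R B"
      using sc by (auto split: tie_break.splits)
    with above(1) show ?thesis
      using ranked_above_tied_H2H[of ?R A B] tie by auto
  qed
  have "leg_points A B \<le> 3" "leg_points B A \<le> 3"
    by (rule leg_points_le)+
  with key[of "(M, 0)"] key[of "(0, M)"] base_eq b base_gaps(2,3) base_C_eq_iff show False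
    by (auto simp: points_among_outcome tied_teams_def points_outcome match_points_M split: if_splits)
qed

text \<open>Only the two matches between \<open>A\<close> and \<open>j\<close> count, and both
  precede Matchday 6.\<close>

lemma pair_comparison:
  assumes "rule = Head_To_Head" "j = C \<or> j = D"
    and T: "tied_teams (outcome u v) A = {A, j}" "tied_teams (outcome u' v') A = {A, j}"
  shows "ranked_above rule (outcome u v) j A \<longleftrightarrow> ranked_above rule (outcome u' v') j A"
    and "ranked_above rule (outcome u v) A j \<longleftrightarrow> ranked_above rule (outcome u' v') A j"
proof -
  have tie: "points (outcome u v) j = points (outcome u v) A"
    "points (outcome u' v') j = points (outcome u' v') A"
    using T by (auto simp: tied_teams_def)
  have eq: "points_among {A, j} (outcome u v) X = points_among {A, j} (outcome u' v') X"
    "goal_diff_among {A, j} (outcome u v) X = goal_diff_among {A, j} (outcome u' v') X"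
    if "X = A \<or> X = j" for X
    unfolding points_among_duel goal_diff_among_duel sum_teams using that assms(2)
    by (elim disjE; simp add: duel_points_outcome duel_goals_outcome distinct')+
  show "ranked_above rule (outcome u v) j A \<longleftrightarrow> ranked_above rule (outcome u' v') j A"
    "ranked_above rule (outcome u v) A j \<longleftrightarrow> ranked_above rule (outcome u' v') A j"
    using tie eq by (simp_all add: ranked_above_tied_H2H[OF assms(1)] T)
qed

lemma base_C_not_level: "base C \<noteq> base A"
proof
  assume c: "base C = base A"
  let ?W = "outcome (M, 0) (M, 0)" and ?L = "outcome (0, M) (0, M)"
  have d: "base D = base A"
    using c base_C_eq_iff by simp
  have tie: "points ?W C = points ?W A" "points ?L C = points ?L A"
    using c by (simp_all add: points_outcome match_points_M)
  have above: "ranked_above rule ?W C A" "ranked_above rule ?L A C" "\<not> ranked_above rule ?L C A"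
    using tied_win[of "(M, 0)" C] tied_loss[of "(0, M)" C] tie distinct' by auto
  show False
  proof (cases rule)
    case Goal_Difference
    then have "goal_diff_among UNIV ?W A < goal_diff_among UNIV ?W C"
      "goal_diff_among UNIV ?L C < goal_diff_among UNIV ?L A"
      using above tie by (auto simp: ranked_above_def)
    \<comment> \<open>The goal differences of \<open>A\<close> and \<open>C\<close> both shift by
      \<open>M\<close> in \<open>?W\<close> and by \<open>-M\<close> in \<open>?L\<close>, so their
      order cannot change.\<close>
    then show False
      unfolding goal_diff_among_duel sum_teams using distinct'
      by (simp add: duel_goals_outcome)
  next
    case Head_To_Head
    \<comment> \<open>\<open>D\<close> starts level but has the opposite result to \<open>A\<close>
      and \<open>C\<close>, and \<open>B\<close> would tie only with a gap of exactly 3.\<close>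
    have "tied_teams ?W A = {A, C}" "tied_teams ?L A = {A, C}"
      using team_cases c d base_gaps(1) base_B_not_win base_B_not_loss
      by (force simp: tied_teams_def points_outcome match_points_M)+
    then show False
      using pair_comparison(1)[OF Head_To_Head, of C] above by blast
  qed
qed

section \<open>The final position under arbitrary results\<close>

definition ahead :: "'t set" where
  "ahead = {j. j \<noteq> A \<and> base A + 3 \<le> base j}"

lemma position_ahead: "P = {Suc (card ahead)}"
  using position_eq[of "(M, 0)"] base_gaps base_C_not_level base_C_eq_iff base_B_not_win
  unfolding ahead_def card_teams_except
  by (auto simp: points_outcome match_points_M)

lemma match_points_cases:
  "match_points m n = 3 \<and> match_points n m = 0 \<or> match_points m n = 1 \<and> match_points n m = 1 \<or>
   match_points m n = 0 \<and> match_points n m = 3"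
  by (auto simp: match_points_def)

text \<open>A gap of at least 3 to \<open>C\<close> closes only if one of \<open>A\<close> and
  \<open>C\<close> wins and the other loses. Then \<open>D\<close> gets as many points as
  \<open>A\<close>, so its gap stays open. The gap to \<open>B\<close> exceeds 3 and cannot
  close.\<close>

lemma tied_CD:
  assumes "j = C \<or> j = D" "points (outcome u v) j = points (outcome u v) A"
  shows "tied_teams (outcome u v) A = {A, j}"
proof -
  have no_tie: "base C \<noteq> base A" "base D \<noteq> base A" "base B \<noteq> base A + 3" "base B + 3 \<noteq> base A"
    using base_C_not_level base_C_eq_iff base_B_not_win base_B_not_loss by auto
  have "points (outcome u v) B \<noteq> points (outcome u v) A"
    using base_gaps(1) no_tie(3,4) match_points_cases[of "fst u" "snd u"]
    unfolding points_outcome by linarith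
  moreover have "points (outcome u v) C \<noteq> points (outcome u v) A \<or>
      points (outcome u v) D \<noteq> points (outcome u v) A"
    using base_gaps(2,3) no_tie(1,2) match_points_cases[of "fst u" "snd u"]
      match_points_cases[of "fst v" "snd v"]
    unfolding points_outcome by linarith
  ultimately have "points (outcome u v) X = points (outcome u v) A \<longleftrightarrow> X = A \<or> X = j" for X
    using team_cases[of X] assms distinct' by metis
  then show ?thesis
    by (auto simp: tied_teams_def)
qed

lemma ahead_above:
  assumes "j \<in> ahead"
  shows "ranked_above rule (outcome u v) j A"
proof (cases "points (outcome u v) A < points (outcome u v) j")
  case True
  then show ?thesis
    by (simp add: ranked_above_def)
next
  case False
  have j: "j \<noteq> A" "base A + 3 \<le> base j"
    using assms by (auto simp: ahead_def)
  have B: "j \<noteq> B"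
    using False j base_B_not_win match_points_cases[of "fst u" "snd u"] by (auto simp: points_outcome)
  then have jCD: "j = C \<or> j = D"
    using team_cases j by blast
  \<comment> \<open>As \<open>j\<close> is not in front of \<open>A\<close> on points, the lead was
    exactly 3, \<open>A\<close> has won and \<open>j\<close> has lost. The tie therefore recurs in
    the extreme scenario where \<open>A\<close> wins and \<open>v'\<close> makes \<open>j\<close>
    lose.\<close>
  define v' where "v' = (if j = C then (0, M) else (M, 0))"
  have v': "v' \<in> {(M, 0), (0, M)}"
    by (simp add: v'_def)
  let ?R = "outcome (M, 0) v'"
  have tie: "points (outcome u v) j = points (outcome u v) A" "points ?R j = points ?R A"
    using False j jCD match_points_cases[of "fst u" "snd u"] distinct'
    by (auto simp: points_outcome match_points_M v'_def)
  have above: "ranked_above rule ?R j A" "\<not> ranked_above rule ?R A j"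
    using tied_win[OF v' j(1)] tie by auto
  \<comment> \<open>Under goal difference, \<open>A\<close> with \<open>M\<close> goals would be
    above \<open>j\<close>, which scores none on Matchday 6, contradicting
    \<open>tied_win\<close>.\<close>
  have rule: "rule = Head_To_Head"
  proof (rule tie_break.exhaust[of rule])
    assume "rule = Goal_Difference"
    then show ?thesis
      using outcome_high[OF insertI1 v' tie(2)[symmetric]] above(2) jCD M_pos distinct'
      by (auto simp: scores_among_outcome v'_def split: if_splits)
  qed
  show ?thesis
    using pair_comparison(1)[OF rule jCD tied_CD tied_CD] jCD tie above by blast
qed

lemma behind_below:
  assumes "j \<notin> ahead" "j \<noteq> A"
  shows "ranked_above rule (outcome u v) A j"
proof (cases "points (outcome u v) j < points (outcome u v) A")
  case True
  then show ?thesis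
    by (simp add: ranked_above_def)
next
  case False
  have j: "j \<noteq> A" "base j + 3 \<le> base A"
    using assms team_cases[of j] base_gaps base_C_not_level base_C_eq_iff by (auto simp: ahead_def)
  have B: "j \<noteq> B"
    using False j base_B_not_loss match_points_cases[of "fst u" "snd u"] by (auto simp: points_outcome)
  then have jCD: "j = C \<or> j = D"
    using team_cases j by blast
  \<comment> \<open>Dually, the only possible tie has \<open>j\<close> winning and \<open>A\<close>
    losing; \<open>v'\<close> is the extreme win of \<open>j\<close>.\<close>
  define v' where "v' = (if j = C then (M, 0) else (0, M))"
  have v': "v' \<in> {(M, 0), (0, M)}"
    by (simp add: v'_def)
  let ?R = "outcome (0, M) v'"
  have tie: "points (outcome u v) j = points (outcome u v) A" "points ?R j = points ?R A"
    using False j jCD match_points_cases[of "fst v" "snd v"] distinct'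
    by (auto simp: points_outcome match_points_M v'_def)
  have above: "ranked_above rule ?R A j" "\<not> ranked_above rule ?R j A"
    using tied_loss[OF v' j(1)] tie by auto
  have rule: "rule = Head_To_Head"
  proof (rule tie_break.exhaust[of rule])
    assume "rule = Goal_Difference"
    then show ?thesis
      using outcome_high[OF insertI2[OF insertI1] v' tie(2)] above(2) jCD M_pos distinct'
      by (auto simp: scores_among_outcome v'_def split: if_splits)
  qed
  show ?thesis
    using pair_comparison(2)[OF rule jCD tied_CD tied_CD] jCD tie above by blast
qed

lemma final_positions_outcome: "final_positions rule (outcome u v) A = P"
  unfolding position_ahead
  by (rule final_positions_eqI[OF finite_teams _ ahead_above behind_below]) (simp_all add: ahead_def)

end

section \<open>Reduction of the theorem to a team of the first game\<close>

lemma matchday_teams: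
  fixes sched :: "nat \<Rightarrow> 't match set"
  assumes "double_round_robin sched" "d \<in> {1..6}" "sched d = {(h1, a1), (h2, a2)}"
    and "(h1, a1) \<noteq> (h2, a2)"
  shows "UNIV = {h1, a1, h2, a2}" "distinct [h1, a1, h2, a2]"
proof -
  note sched = assms(1)[unfolded double_round_robin_def]
  have irr: "(i, i) \<notin> sched d" for i
    using sched[THEN conjunct1] assms(2) by blast
  have one: "\<exists>!m. m \<in> {(h1, a1), (h2, a2)} \<and> (i = fst m \<or> i = snd m)" for i
    using bspec[OF sched[THEN conjunct2, THEN conjunct1] assms(2)] unfolding assms(3) by blast
  have "i \<in> {h1, a1, h2, a2}" for i
    using ex1_implies_ex[OF one[of i]] by auto
  then show "UNIV = {h1, a1, h2, a2}"
    by blast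
  have "\<not> ((i = h1 \<or> i = a1) \<and> (i = h2 \<or> i = a2))" for i
    using one[of i] assms(4) by (metis fst_conv insertCI snd_conv)
  from this[of h1] this[of a1] irr[of h1] irr[of h2] assms(3)
  show "distinct [h1, a1, h2, a2]"
    by auto
qed

lemma final_results_swap:
  "g1 \<noteq> g2 \<Longrightarrow> final_results known g1 g2 x y = final_results known g2 g1 y x"
  by (simp add: final_results_def fun_upd_twist)

lemma high_number_swap:
  assumes "g1 \<noteq> g2" "high_number rule known g1 g2 M"
  shows "high_number rule known g2 g1 M"
  using assms(2) unfolding high_number_def Let_def final_results_swap[OF assms(1)[symmetric]]
  by (simp add: insert_commute)

text \<open>The locale calls the team in question \<open>A\<close>, so the away team is covered by
  exchanging the names of the two opponents; \<open>prod.swap\<close> then restores the order of the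
  goals.\<close>

lemma first_game_team_position:
  fixes h1 :: 't
  assumes teams: "UNIV = {h1, a1, h2, a2}" "distinct [h1, a1, h2, a2]"
    and high: "high_number rule known (h1, a1) (h2, a2) M"
    and same: "\<And>x y. x \<in> {(M, 0), (0, M)} \<Longrightarrow> y \<in> {(M, 0), (0, M)} \<Longrightarrow>
      final_positions rule (final_results known (h1, a1) (h2, a2) x y) i = P"
    and i: "i = h1 \<or> i = a1"
  shows "final_positions rule (final_results known (h1, a1) (h2, a2) x y) i = P"
  using i
proof
  assume "i = h1"
  interpret final_matchday h1 a1 h2 a2 known "(h1, a1)" rule M P
    using teams high same \<open>i = h1\<close> by unfold_locales auto
  show ?thesis
    using final_positions_outcome[of x y] \<open>i = h1\<close> by (simp add: outcome_def)
next
  assume "i = a1"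
  interpret final_matchday a1 h1 h2 a2 known "(h1, a1)" rule M P
    using teams high same \<open>i = a1\<close> by unfold_locales auto
  show ?thesis
    using final_positions_outcome[of "prod.swap x" y] \<open>i = a1\<close> distinct by (simp add: outcome_def)
qed

theorem proposition3p5:
  fixes sched :: "nat \<Rightarrow> 't match set"
    and known :: "'t results"
    and g1 g2 :: "'t match"
    and rule :: tie_break
    and M :: nat
    and i :: 't
    and P :: "nat set"
  assumes four_teams: "card (UNIV :: 't set) = 4"
    and schedule: "double_round_robin sched"
    and matchday6: "sched 6 = {g1, g2}" "g1 \<noteq> g2"
    and high: "high_number rule known g1 g2 M"
    and scenario_a: "final_positions rule (final_results known g1 g2 (M, 0) (M, 0)) i = P"
    and scenario_b: "final_positions rule (final_results known g1 g2 (M, 0) (0, M)) i = P"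
    and scenario_c: "final_positions rule (final_results known g1 g2 (0, M) (M, 0)) i = P"
    and scenario_d: "final_positions rule (final_results known g1 g2 (0, M) (0, M)) i = P"
  shows "\<forall>x y. final_positions rule (final_results known g1 g2 x y) i = P"
proof (intro allI)
  fix x y
  obtain h1 a1 h2 a2 where g: "g1 = (h1, a1)" "g2 = (h2, a2)"
    using surj_pair by metis
  have T: "UNIV = {h1, a1, h2, a2}" "distinct [h1, a1, h2, a2]"
    using matchday_teams[OF schedule _ matchday6[unfolded g]] by simp_all
  then have T': "UNIV = {h2, a2, h1, a1}" "distinct [h2, a2, h1, a1]"
    by auto
  have same: "final_positions rule (final_results known g1 g2 u v) i = P"
    if "u \<in> {(M, 0), (0, M)}" "v \<in> {(M, 0), (0, M)}" for u v
    using that scenario_a scenario_b scenario_c scenario_d by auto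
  have "i \<in> {h1, a1, h2, a2}"
    using T(1) by blast
  then consider "i = h1 \<or> i = a1" | "i = h2 \<or> i = a2"
    by blast
  then show "final_positions rule (final_results known g1 g2 x y) i = P"
  proof cases
    case 1
    show ?thesis
      unfolding g by (rule first_game_team_position[OF T high[unfolded g] same[unfolded g] 1])
  next
    case 2
    \<comment> \<open>A team of the second game is treated by exchanging the roles of the two
      games.\<close>
    have "final_positions rule (final_results known g2 g1 y x) i = P"
      unfolding g
    proof (rule first_game_team_position[OF T' _ _ 2])
      show "high_number rule known (h2, a2) (h1, a1) M"
        using high_number_swap[OF matchday6(2) high] g by simp
      show "final_positions rule (final_results known (h2, a2) (h1, a1) u v) i = P"
        if "u \<in> {(M, 0), (0, M)}" "v \<in> {(M, 0), (0, M)}" for u v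
        using same[OF that(2,1)] final_results_swap[OF matchday6(2)] g by simp
    qed
    then show ?thesis
      using final_results_swap[OF matchday6(2)] by simp
  qed
qed

end
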